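(* Let $n\ge 3$ and let $E=(\mathbb{R}^n,B_E)$ and $F=(\mathbb{R}^n,B_F)$ be two non-isometric $n$-dimensional normed spaces satisfying $B_E\subset B_F\subset d(E,F)\,B_E$. For $\lambda\in(0,1)$ put $$B_\lambda=\bigl(d(E,F)^\lambda B_E\bigr)\cap B_F,\qquad C_\lambda=\mathrm{Conv}\Bigl[B_E\cup \tfrac{1}{d(E,F)^{1-\lambda}}B_F\Bigr].$$ Then for each $\lambda\in(0,1)$ the set of normed spaces $X=(\mathbb{R}^n,B_X)$ with $C_\lambda\subset B_X\subset B_\lambda$ contains uncountably many pairwise non-isometric spaces.
   Context: All normed spaces are real. For $n$-dimensional normed spaces $E,F$, the (multiplicative) Banach-Mazur distance is $d(E,F)=\inf\{\|T\|\,\|T^{-1}\| : T:E\to F \text{ is an isomorphism}\}$. A normed space written $(\mathbb{R}^n,B)$ is $\mathbb{R}^n$ with the norm whose closed unit ball is the symmetric convex body $B$. $\mathrm{Conv}(S)$ is the convex hull of $S$. *)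

theory Defs
  imports "HOL-Analysis.Analysis"
begin

(* An n-dimensional normed space (R^n, B) is represented by its closed unit ball B.
   The library's norm on real^'n is the Euclidean one; it enters only through the topology,
   which is the same for every norm. *)

definition symmetric_convex_body :: "'a::euclidean_space set \<Rightarrow> bool" where
  "symmetric_convex_body B \<longleftrightarrow>
     convex B \<and> compact B \<and> interior B \<noteq> {} \<and> (\<forall>x\<in>B. - x \<in> B)"

(* The norm with closed unit ball B, as the Minkowski functional of B. The lemmas
   body_norm_le_one_iff, body_norm_eq_0_iff, body_norm_scaleR and body_norm_triangle below
   show that it is a norm with unit ball B when B is a symmetric convex body. *)
definition body_norm :: "'a::euclidean_space set \<Rightarrow> 'a \<Rightarrow> real" where
  "body_norm B x = Inf {t. 0 < t \<and> x \<in> (*\<^sub>R) t ` B}"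

(* The supremum is over a nonempty bounded set whenever T is linear and B, C are symmetric
   convex bodies; see bdd_above_body_opnorm. *)
definition body_opnorm ::
  "'a::euclidean_space set \<Rightarrow> 'b::euclidean_space set \<Rightarrow> ('a \<Rightarrow> 'b) \<Rightarrow> real" where
  "body_opnorm B C T = (SUP x\<in>{x. body_norm B x \<le> 1}. body_norm C (T x))"

definition banach_mazur_dist ::
  "'a::euclidean_space set \<Rightarrow> 'b::euclidean_space set \<Rightarrow> real" where
  "banach_mazur_dist B C =
     Inf {body_opnorm B C T * body_opnorm C B (inv T) | T. linear T \<and> bij T}"

(* Isometric as normed spaces: there is a linear isometry of one space onto the other. *)
definition isometric_spaces ::
  "'a::euclidean_space set \<Rightarrow> 'b::euclidean_space set \<Rightarrow> bool" where
  "isometric_spaces B C \<longleftrightarrow>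
     (\<exists>T. linear T \<and> bij T \<and> (\<forall>x. body_norm C (T x) = body_norm B x))"

definition outer_body ::
  "real \<Rightarrow> 'a::euclidean_space set \<Rightarrow> 'a set \<Rightarrow> 'a set" where
  "outer_body l BE BF = ((*\<^sub>R) (banach_mazur_dist BE BF powr l) ` BE) \<inter> BF"

definition inner_body ::
  "real \<Rightarrow> 'a::euclidean_space set \<Rightarrow> 'a set \<Rightarrow> 'a set" where
  "inner_body l BE BF =
     convex hull (BE \<union> (*\<^sub>R) (1 / banach_mazur_dist BE BF powr (1 - l)) ` BF)"

lemma mem_scaleR_image_iff:
  fixes x :: "'a::real_vector"
  assumes "t \<noteq> 0"
  shows "x \<in> (*\<^sub>R) t ` B \<longleftrightarrow> x /\<^sub>R t \<in> B"
  using assms by (auto simp: image_iff intro!: bexI[of _ "x /\<^sub>R t"])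

lemma symmetric_convex_body_ball:
  assumes "symmetric_convex_body B"
  obtains e where "e > 0" "ball 0 e \<subseteq> B"
proof -
  have c: "convex B" and s: "\<And>x. x \<in> B \<Longrightarrow> - x \<in> B"
    using assms by (auto simp: symmetric_convex_body_def)
  obtain a where "a \<in> interior B"
    using assms by (auto simp: symmetric_convex_body_def)
  then obtain e where e: "e > 0" "ball a e \<subseteq> B"
    by (auto simp: mem_interior)
  have "y \<in> B" if "y \<in> ball 0 e" for y
  proof -
    have "a + y \<in> B" "a - y \<in> B"
      using e(2) that by (auto simp: dist_norm subset_iff)
    then have "(1/2) *\<^sub>R (a + y) + (1/2) *\<^sub>R (- (a - y)) \<in> B"
      by (intro convexD[OF c] s) auto
    moreover have "(1/2) *\<^sub>R (a + y) + (1/2) *\<^sub>R (- (a - y)) = y"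
      by (simp flip: scaleR_right_distrib scaleR_2)
    ultimately show ?thesis by simp
  qed
  then show ?thesis using e that by blast
qed

lemma body_norm_le_iff:
  assumes B: "symmetric_convex_body B" and t: "t > 0"
  shows "body_norm B x \<le> t \<longleftrightarrow> x \<in> (*\<^sub>R) t ` B"
proof -
  let ?S = "{t. 0 < t \<and> x \<in> (*\<^sub>R) t ` B}"
  have c: "convex B" and cl: "closed B"
    using B by (auto simp: symmetric_convex_body_def compact_imp_closed)
  obtain e where e: "e > 0" "ball 0 e \<subseteq> B" by (rule symmetric_convex_body_ball[OF B])
  have z: "0 \<in> B" using e by auto
  have bdd: "bdd_below ?S" by (rule bdd_belowI[of _ 0]) auto
  define r where "r = (norm x + 1) / (e/2)"
  have r: "r > 0" using e by (simp add: r_def add_nonneg_pos)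
  have "norm (x /\<^sub>R r) = norm x / r" using r by (simp add: field_simps)
  also have "\<dots> < e" using e r unfolding r_def by (simp add: field_simps add_nonneg_pos)
  finally have "x /\<^sub>R r \<in> B" using e by auto
  then have ne: "?S \<noteq> {}" using r by (auto simp: mem_scaleR_image_iff simp del: scaleR_eq_0_iff)
  have up: "x /\<^sub>R u \<in> B" if "0 < s" "x /\<^sub>R s \<in> B" "s \<le> u" for s u
  proof -
    have "(s/u) *\<^sub>R (x /\<^sub>R s) + (1 - s/u) *\<^sub>R 0 \<in> B"
      using that z by (intro convexD[OF c]) auto
    then show ?thesis using that by (simp add: field_simps)
  qed
  show ?thesis
  proof
    assume "x \<in> (*\<^sub>R) t ` B"
    then show "body_norm B x \<le> t"
      unfolding body_norm_def using t by (intro cInf_lower bdd) auto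
  next
    assume le: "body_norm B x \<le> t"
    have u: "x /\<^sub>R u \<in> B" if "u > t" for u
    proof -
      have "Inf ?S < u" using le that by (simp add: body_norm_def)
      then obtain s where "s \<in> ?S" "s < u" using cInf_lessD[OF ne] by blast
      then show ?thesis using up[of s u] by (auto simp: mem_scaleR_image_iff[of s])
    qed
    have "(\<lambda>n. x /\<^sub>R (t + 1 / real (Suc n))) \<longlonglongrightarrow> x /\<^sub>R (t + 0)"
      using t by (intro tendsto_intros LIMSEQ_Suc lim_1_over_n) auto
    then have "x /\<^sub>R (t + 0) \<in> B"
      by (rule closed_sequentially[OF cl, rotated]) (auto intro!: u)
    then show "x \<in> (*\<^sub>R) t ` B" using t by (simp add: mem_scaleR_image_iff)
  qed
qed

lemma body_norm_le_one_iff: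
  assumes "symmetric_convex_body B"
  shows "body_norm B x \<le> 1 \<longleftrightarrow> x \<in> B"
  using body_norm_le_iff[OF assms, of 1 x] by simp

lemma body_norm_nonneg:
  assumes B: "symmetric_convex_body B"
  shows "0 \<le> body_norm B x"
proof (rule ccontr)
  assume neg: "\<not> ?thesis"
  have "{t. 0 < t \<and> x \<in> (*\<^sub>R) t ` B} \<noteq> {}"
    using body_norm_le_iff[OF B, of 1 x] neg by (auto intro!: exI[of _ 1])
  then have "0 \<le> body_norm B x"
    unfolding body_norm_def by (rule cInf_greatest) auto
  with neg show False by simp
qed

lemma body_norm_eq_0_iff:
  assumes B: "symmetric_convex_body B"
  shows "body_norm B x = 0 \<longleftrightarrow> x = 0"
proof
  assume "x = 0"
  obtain e where e: "e > 0" "ball 0 e \<subseteq> B" by (rule symmetric_convex_body_ball[OF B])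
  have "body_norm B x \<le> t" if "t > 0" for t
    using that e \<open>x = 0\<close> by (auto simp: body_norm_le_iff[OF B] mem_scaleR_image_iff)
  then have "body_norm B x \<le> 0" by (meson field_le_epsilon le_add_same_cancel2 dense_ge)
  then show "body_norm B x = 0" using body_norm_nonneg[OF B, of x] by simp
next
  assume z: "body_norm B x = 0"
  obtain K where K: "K > 0" "\<And>y. y \<in> B \<Longrightarrow> norm y \<le> K"
    using B by (metis symmetric_convex_body_def compact_imp_bounded bounded_pos)
  have "norm x \<le> t" if "t > 0" for t
  proof -
    have "x /\<^sub>R (t/K) \<in> B"
      using that K(1) z body_norm_le_iff[OF B, of "t/K" x] by (simp add: mem_scaleR_image_iff)
    from K(2)[OF this] show ?thesis using that K(1) by (simp add: field_simps)
  qed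
  then have "norm x \<le> 0" by (meson dense_ge)
  then show "x = 0" by simp
qed

lemma body_norm_scaleR:
  assumes B: "symmetric_convex_body B"
  shows "body_norm B (c *\<^sub>R x) = \<bar>c\<bar> * body_norm B x"
proof (cases "c = 0")
  case True
  then show ?thesis using body_norm_eq_0_iff[OF B, of 0] by simp
next
  case False
  have sym: "- y \<in> B \<longleftrightarrow> y \<in> B" for y
    using B unfolding symmetric_convex_body_def by (metis minus_minus)
  have le: "body_norm B (c *\<^sub>R x) \<le> t \<longleftrightarrow> \<bar>c\<bar> * body_norm B x \<le> t" if t: "t > 0" for t
  proof -
    have "body_norm B (c *\<^sub>R x) \<le> t \<longleftrightarrow> (c / t) *\<^sub>R x \<in> B"
      using t by (simp add: body_norm_le_iff[OF B] mem_scaleR_image_iff divide_inverse_commute)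
    also have "\<dots> \<longleftrightarrow> (\<bar>c\<bar> / t) *\<^sub>R x \<in> B"
      using sym[of "(c / t) *\<^sub>R x"] by (auto simp: abs_if)
    also have "\<dots> \<longleftrightarrow> body_norm B x \<le> t / \<bar>c\<bar>"
      using t False by (simp add: body_norm_le_iff[OF B] mem_scaleR_image_iff)
    also have "\<dots> \<longleftrightarrow> \<bar>c\<bar> * body_norm B x \<le> t"
      using False by (simp add: field_simps)
    finally show ?thesis .
  qed
  show ?thesis
  proof (rule antisym)
    show "body_norm B (c *\<^sub>R x) \<le> \<bar>c\<bar> * body_norm B x"
      by (rule dense_ge) (metis le less_imp_le le_less_trans body_norm_nonneg[OF B] mult_nonneg_nonneg abs_ge_zero)
    show "\<bar>c\<bar> * body_norm B x \<le> body_norm B (c *\<^sub>R x)"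
      by (rule dense_ge) (metis le less_imp_le le_less_trans body_norm_nonneg[OF B])
  qed
qed

lemma body_norm_triangle:
  assumes B: "symmetric_convex_body B"
  shows "body_norm B (x + y) \<le> body_norm B x + body_norm B y"
proof -
  have c: "convex B" using B by (simp add: symmetric_convex_body_def)
  have *: "body_norm B (x + y) \<le> s + t" if "body_norm B x < s" "body_norm B y < t" for s t
  proof -
    have pos: "s > 0" "t > 0" using that body_norm_nonneg[OF B] by (meson le_less_trans)+
    have "x /\<^sub>R s \<in> B" "y /\<^sub>R t \<in> B"
      using that pos body_norm_le_iff[OF B] mem_scaleR_image_iff by (metis less_imp_le less_irrefl)+
    then have "(s/(s+t)) *\<^sub>R (x /\<^sub>R s) + (t/(s+t)) *\<^sub>R (y /\<^sub>R t) \<in> B"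
      using pos by (intro convexD[OF c]) (auto simp flip: add_divide_distrib)
    also have "(s/(s+t)) *\<^sub>R (x /\<^sub>R s) + (t/(s+t)) *\<^sub>R (y /\<^sub>R t) = (x + y) /\<^sub>R (s + t)"
      using pos by (simp add: scaleR_right_distrib divide_simps)
    finally show ?thesis using pos by (simp add: body_norm_le_iff[OF B] mem_scaleR_image_iff)
  qed
  show ?thesis
  proof (rule field_le_epsilon)
    fix e :: real assume "e > 0"
    then show "body_norm B (x + y) \<le> body_norm B x + body_norm B y + e"
      using *[of "body_norm B x + e/2" "body_norm B y + e/2"] by simp
  qed
qed

lemma bdd_above_body_opnorm:
  assumes B: "symmetric_convex_body B" and C: "symmetric_convex_body C" and T: "linear T"
  shows "bdd_above ((\<lambda>x. body_norm C (T x)) ` {x. body_norm B x \<le> 1})"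
proof -
  obtain e where e: "e > 0" "ball 0 e \<subseteq> C" by (rule symmetric_convex_body_ball[OF C])
  have "bounded (T ` B)"
    using B T by (simp add: symmetric_convex_body_def bounded_linear_image compact_imp_bounded
        linear_conv_bounded_linear)
  then obtain K where K: "K > 0" "\<And>x. x \<in> B \<Longrightarrow> norm (T x) \<le> K"
    by (auto simp: bounded_pos)
  show ?thesis
  proof (rule bdd_aboveI2)
    fix x assume "x \<in> {x. body_norm B x \<le> 1}"
    then have "norm (T x) \<le> K" using K B by (simp add: body_norm_le_one_iff)
    then have "norm (T x /\<^sub>R (2 * K / e)) < e" using K(1) e(1) by (simp add: field_simps)
    then have "T x /\<^sub>R (2 * K / e) \<in> C" using e by auto
    then show "body_norm C (T x) \<le> 2 * K / e"
      using K(1) e(1) by (simp add: body_norm_le_iff[OF C] mem_scaleR_image_iff)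
  qed
qed

end

theory Submission
  imports Defs
begin

text \<open>
  The ratio of the norms of \<open>E\<close> and \<open>F\<close> is a
  nonconstant continuous function on the connected sphere with values in \<open>[1, d]\<close>, hence it takes
  a value other than \<open>1\<close> and \<open>d\<close> at some \<open>x\<close>. The multiple of \<open>x\<close> on the boundary of \<open>B\<^sub>\<lambda>\<close> is not
  in \<open>C\<^sub>\<lambda>\<close>, so \<open>B\<^sub>\<lambda>\<close> is strictly larger than \<open>C\<^sub>\<lambda>\<close>.

  Countably many isometry classes are then excluded by a dimension count. For \<open>N = n\<^sup>2 + 1\<close> one finds
  points \<open>p\<^sub>1, \<dots>, p\<^sub>N\<close> in \<open>B\<^sub>\<lambda>\<close> outside \<open>C\<^sub>\<lambda>\<close> such that every vector \<open>u\<close> in a small cube in \<open>\<real>\<^sup>N\<close> is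
  the list of norms of \<open>p\<^sub>1, \<dots>, p\<^sub>N\<close> for some body between \<open>C\<^sub>\<lambda>\<close> and \<open>B\<^sub>\<lambda>\<close>. If that body is
  isometric to \<open>Y\<close> via the matrix \<open>A\<close>, then \<open>u\<close> lists the \<open>Y\<close>-norms of \<open>A p\<^sub>1, \<dots>, A p\<^sub>N\<close>, so \<open>u\<close> lies
  in the image of an \<open>n\<^sup>2\<close>-dimensional space under a Lipschitz map depending only on \<open>Y\<close>. Such
  images are null sets, and countably many of them cannot cover the cube.
\<close>

section \<open>Convex hulls and norms of symmetric convex bodies\<close>

text \<open>Interior points are inherited from \<open>C\<close>, and the hull commutes with the
  reflection at 0. This serves both for the inner body and for the bodies built from finitely many
  extra points.\<close>

lemma symmetric_convex_body_hull_Un: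
  fixes C :: "'a::euclidean_space set"
  assumes C: "symmetric_convex_body C" and S: "compact S" "\<And>x. x \<in> S \<Longrightarrow> - x \<in> S"
  shows "symmetric_convex_body (convex hull (C \<union> S))"
proof -
  have "(*\<^sub>R) (- 1) ` (C \<union> S) = C \<union> S"
    using C S(2) unfolding symmetric_convex_body_def by (force simp: image_iff intro: bexI[of _ "- _"])
  then have "(*\<^sub>R) (- 1) ` (convex hull (C \<union> S)) = convex hull (C \<union> S)"
    by (metis convex_hull_scaling)
  then have "- x \<in> convex hull (C \<union> S)" if "x \<in> convex hull (C \<union> S)" for x
    using that by (metis imageI scaleR_minus1_left)
  moreover have "interior C \<subseteq> interior (convex hull (C \<union> S))"
    by (intro interior_mono order_trans[OF _ hull_subset]) simp
  ultimately show ?thesis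
    using C S(1) by (auto simp: symmetric_convex_body_def intro!: compact_convex_hull compact_Un)
qed

lemma body_norm_zero [simp]: "symmetric_convex_body B \<Longrightarrow> body_norm B 0 = 0"
  by (simp add: body_norm_eq_0_iff)

lemma body_norm_pos:
  assumes "symmetric_convex_body B" "x \<noteq> 0"
  shows "0 < body_norm B x"
  using body_norm_nonneg[OF assms(1), of x] body_norm_eq_0_iff[OF assms(1), of x] assms(2) by simp

lemma body_norm_combination:
  assumes "symmetric_convex_body B" "0 \<le> s" "0 \<le> t"
  shows "body_norm B (s *\<^sub>R x + t *\<^sub>R y) \<le> s * body_norm B x + t * body_norm B y"
  using body_norm_triangle[OF assms(1), of "s *\<^sub>R x" "t *\<^sub>R y"] assms
  by (simp add: body_norm_scaleR)

lemma body_norm_le_if_subset: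
  assumes A: "symmetric_convex_body A" and B: "symmetric_convex_body B" and s: "s > 0"
    and sub: "A \<subseteq> (*\<^sub>R) s ` B"
  shows "body_norm B x \<le> s * body_norm A x"
proof (cases "x = 0")
  case True
  then show ?thesis using A B by simp
next
  case False
  have pos: "body_norm A x > 0" by (rule body_norm_pos[OF A False])
  have "x /\<^sub>R body_norm A x \<in> A"
    using body_norm_le_iff[OF A pos, of x] pos by (simp add: mem_scaleR_image_iff)
  then have "x /\<^sub>R body_norm A x /\<^sub>R s \<in> B"
    using sub s mem_scaleR_image_iff[of s "x /\<^sub>R body_norm A x" B] by auto
  then show ?thesis
    using pos s body_norm_le_iff[OF B, of "s * body_norm A x" x]
    by (simp add: mem_scaleR_image_iff mult.commute)
qed

text \<open>By homogeneity, a half-space containing the body bounds its norm from below; this is how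
  norms of constructed bodies are computed exactly.\<close>

lemma inner_le_body_norm:
  assumes B: "symmetric_convex_body B" and c: "\<And>x. x \<in> B \<Longrightarrow> v \<bullet> x \<le> c"
  shows "v \<bullet> y \<le> c * body_norm B y"
proof (cases "y = 0")
  case True
  then show ?thesis using B by simp
next
  case False
  have pos: "body_norm B y > 0" by (rule body_norm_pos[OF B False])
  have "y /\<^sub>R body_norm B y \<in> B"
    using body_norm_le_iff[OF B pos, of y] pos by (simp add: mem_scaleR_image_iff)
  from c[OF this] show ?thesis using pos by (simp add: field_simps)
qed

text \<open>An open ball of radius \<open>e\<close> inside \<open>B\<close> bounds the norm by
  \<open>2 / e\<close> times the Euclidean norm, and the triangle inequality does the rest.\<close>

lemma body_norm_Lipschitz:
  assumes B: "symmetric_convex_body B"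
  obtains K where "K > 0" "\<And>x y. \<bar>body_norm B x - body_norm B y\<bar> \<le> K * norm (x - y)"
proof -
  obtain e where e: "e > 0" "ball 0 e \<subseteq> B" by (rule symmetric_convex_body_ball[OF B])
  have bound: "body_norm B x \<le> 2 / e * norm x" for x
  proof (cases "x = 0")
    case True
    then show ?thesis using B by simp
  next
    case False
    then have "x /\<^sub>R (2 / e * norm x) \<in> B"
      using e by (intro subsetD[OF e(2)]) (simp add: field_simps)
    then show ?thesis
      using False e(1) by (simp add: body_norm_le_iff[OF B] mem_scaleR_image_iff)
  qed
  have "body_norm B x - body_norm B y \<le> 2 / e * norm (x - y)" for x y
    using body_norm_triangle[OF B, of y "x - y"] bound[of "x - y"] by simp
  then have "\<bar>body_norm B x - body_norm B y\<bar> \<le> 2 / e * norm (x - y)" for x y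
    by (smt (verit) norm_minus_commute)
  then show ?thesis using e(1) that[of "2 / e"] by auto
qed

lemma continuous_on_body_norm:
  assumes "symmetric_convex_body B"
  shows "continuous_on S (body_norm B)"
proof -
  obtain K where K: "K > 0" "\<And>x y. \<bar>body_norm B x - body_norm B y\<bar> \<le> K * norm (x - y)"
    by (rule body_norm_Lipschitz[OF assms]) blast
  have "K-lipschitz_on S (body_norm B)"
    using K by (intro lipschitz_onI) (auto simp: dist_real_def dist_norm less_imp_le)
  then show ?thesis by (rule lipschitz_on_continuous_on)
qed

section \<open>Isometry as an equivalence relation\<close>

lemma isometric_spaces_refl: "isometric_spaces X X"
  unfolding isometric_spaces_def by (rule exI[of _ id]) (simp add: linear_id)

lemma isometric_spaces_sym:
  fixes X Y :: "'a::euclidean_space set"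
  assumes "isometric_spaces X Y"
  shows "isometric_spaces Y X"
proof -
  obtain T where T: "linear T" "bij T" "\<And>x. body_norm Y (T x) = body_norm X x"
    using assms by (auto simp: isometric_spaces_def)
  have "linear (inv T)"
    by (rule inj_linear_imp_inv_linear[OF T(1) bij_is_inj[OF T(2)]])
  moreover have "body_norm X (inv T y) = body_norm Y y" for y
    using T(3)[of "inv T y"] T(2) by (simp add: bij_is_surj surj_f_inv_f)
  ultimately show ?thesis
    using T(2) by (auto simp: isometric_spaces_def bij_imp_bij_inv)
qed

lemma isometric_spaces_trans:
  "isometric_spaces X Y \<Longrightarrow> isometric_spaces Y Z \<Longrightarrow> isometric_spaces X Z"
  unfolding isometric_spaces_def
  by (metis bij_comp comp_apply linear_compose)

text \<open>The representative \<open>r X\<close> depends only on the predicate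
  \<open>isometric_spaces X\<close>, which is the same for isometric bodies. Hence every class is
  sent to a single member.\<close>

lemma exists_isometry_transversal:
  fixes G :: "'a::euclidean_space set set"
  shows "\<exists>S\<subseteq>G. pairwise (\<lambda>X Y. \<not> isometric_spaces X Y) S \<and> (\<forall>X\<in>G. \<exists>Y\<in>S. isometric_spaces X Y)"
proof -
  define r where "r X = (SOME Y. Y \<in> G \<and> isometric_spaces X Y)" for X :: "'a set"
  have r: "r X \<in> G" "isometric_spaces X (r X)" if "X \<in> G" for X
    using someI[of "\<lambda>Y. Y \<in> G \<and> isometric_spaces X Y" X] that isometric_spaces_refl
    unfolding r_def by auto
  have "r X = r Y" if "isometric_spaces X Y" for X Y :: "'a set"
  proof -
    have "isometric_spaces X = (isometric_spaces Y :: 'a set \<Rightarrow> bool)"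
    proof (intro ext iffI)
      show "isometric_spaces Y Z" if "isometric_spaces X Z" for Z
        using isometric_spaces_sym[OF \<open>isometric_spaces X Y\<close>] that by (rule isometric_spaces_trans)
      show "isometric_spaces X Z" if "isometric_spaces Y Z" for Z
        using \<open>isometric_spaces X Y\<close> that by (rule isometric_spaces_trans)
    qed
    then show ?thesis by (simp add: r_def)
  qed
  note r_eq = this
  have "r X = r Y" if "X \<in> G" "Y \<in> G" "isometric_spaces (r X) (r Y)" for X Y
  proof (rule r_eq)
    show "isometric_spaces X Y"
      using r(2)[OF that(1)] that(3) isometric_spaces_sym[OF r(2)[OF that(2)]]
      by (rule isometric_spaces_trans[OF isometric_spaces_trans])
  qed
  then have "pairwise (\<lambda>X Y. \<not> isometric_spaces X Y) (r ` G)"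
    unfolding pairwise_def by blast
  moreover have "r ` G \<subseteq> G" "\<forall>X\<in>G. \<exists>Y\<in>r ` G. isometric_spaces X Y"
    using r by blast+
  ultimately show ?thesis by blast
qed

text \<open>The homothety with factor \<open>c\<close> is an isometry.\<close>

lemma isometric_spaces_if_proportional:
  fixes A B :: "'a::euclidean_space set"
  assumes B: "symmetric_convex_body B" and c: "c > 0"
    and eq: "\<And>x. body_norm A x = c * body_norm B x"
  shows "isometric_spaces A B"
  unfolding isometric_spaces_def
proof (intro exI conjI allI)
  show "linear ((*\<^sub>R) c :: 'a \<Rightarrow> 'a)" by (simp add: linear_scaleR)
  have "c \<noteq> 0" using c by simp
  then show "bij ((*\<^sub>R) c :: 'a \<Rightarrow> 'a)"
    by (intro o_bij[of "(*\<^sub>R) (1 / c)"]) (simp_all add: fun_eq_iff)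
  show "body_norm B (c *\<^sub>R x) = body_norm A x" for x
    using body_norm_scaleR[OF B] eq c by simp
qed

section \<open>The ratio of the two norms and the strict inclusion\<close>

text \<open>Otherwise the ratio maps the sphere, connected in dimension at least 2, onto a finite
  connected set. It is then constant, and proportional norms give isometric spaces.\<close>

lemma exists_intermediate_ratio:
  fixes BE BF :: "'a::euclidean_space set"
  assumes dim: "DIM('a) \<ge> 2"
    and E: "symmetric_convex_body BE" and F: "symmetric_convex_body BF"
    and noniso: "\<not> isometric_spaces BE BF"
  shows "\<exists>x. x \<noteq> 0 \<and> body_norm BE x \<noteq> body_norm BF x \<and> body_norm BE x \<noteq> d * body_norm BF x"
proof (rule ccontr)
  assume "\<not> ?thesis"
  then have two: "body_norm BE x = body_norm BF x \<or> body_norm BE x = d * body_norm BF x"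
    if "x \<noteq> 0" for x
    using that by blast
  define q where "q x = body_norm BE x / body_norm BF x" for x
  let ?S = "sphere (0::'a) 1"
  have pos: "body_norm BE x > 0" "body_norm BF x > 0" if "x \<noteq> 0" for x
    using body_norm_pos E F that by blast+
  have "q ` ?S \<subseteq> {1, d}"
  proof
    fix t assume "t \<in> q ` ?S"
    then obtain x where "norm x = 1" "t = q x" by auto
    moreover from this have "x \<noteq> 0" by auto
    ultimately show "t \<in> {1, d}"
      using two[of x] pos(2)[of x] by (auto simp: q_def field_simps)
  qed
  then have fin: "finite (q ` ?S)" by (rule finite_subset) simp
  have "continuous_on ?S q"
    unfolding q_def
    by (intro continuous_intros continuous_on_body_norm E F) (auto simp: body_norm_eq_0_iff[OF F])
  then have "connected (q ` ?S)"
    using dim connected_sphere_eq[of "0::'a" 1] by (intro connected_continuous_image) auto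
  then obtain c where c: "q ` ?S \<subseteq> {c}"
    using fin connected_finite_iff_sing[of "q ` ?S"] by force
  have ratio: "body_norm BE x = c * body_norm BF x" for x
  proof (cases "x = 0")
    case True
    then show ?thesis using E F by simp
  next
    case False
    then have "x /\<^sub>R norm x \<in> ?S" by simp
    then have "q (x /\<^sub>R norm x) = c" using c by blast
    moreover have "q (x /\<^sub>R norm x) = q x"
      using False by (simp add: q_def body_norm_scaleR[OF E] body_norm_scaleR[OF F])
    ultimately show ?thesis using pos(2)[OF False] by (auto simp: q_def)
  qed
  have "c > 0"
  proof -
    obtain b :: 'a where "b \<in> Basis" using nonempty_Basis by blast
    then have "b \<noteq> 0" by auto
    then show ?thesis
      using pos[of b] ratio[of b] by (simp add: zero_less_mult_iff)
  qed
  from isometric_spaces_if_proportional[OF F this ratio] noniso show False by simp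
qed

text \<open>All products of operator norms are nonnegative, and the identity map shows that the
  infimum is taken over a nonempty set.\<close>

lemma banach_mazur_dist_nonneg:
  fixes B C :: "'a::euclidean_space set"
  assumes B: "symmetric_convex_body B" and C: "symmetric_convex_body C"
  shows "banach_mazur_dist B C \<ge> 0"
proof -
  have opnorm: "body_opnorm A D T \<ge> 0"
    if A: "symmetric_convex_body A" and D: "symmetric_convex_body D" and T: "linear T"
    for A D :: "'a set" and T
    unfolding body_opnorm_def
    by (rule cSUP_upper2[OF bdd_above_body_opnorm[OF that], of 0])
      (use A D T in \<open>auto simp: linear_0\<close>)
  have lin: "linear (inv T)" if "linear T" "bij T" for T :: "'a \<Rightarrow> 'a"
    by (rule inj_linear_imp_inv_linear[OF that(1) bij_is_inj[OF that(2)]])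
  show ?thesis
    unfolding banach_mazur_dist_def
  proof (rule cInf_greatest)
    have "linear (id :: 'a \<Rightarrow> 'a) \<and> bij (id :: 'a \<Rightarrow> 'a)" by (simp add: linear_id)
    then show "{body_opnorm B C T * body_opnorm C B (inv T) |T. linear T \<and> bij T} \<noteq> {}"
      by blast
  next
    show "0 \<le> x" if "x \<in> {body_opnorm B C T * body_opnorm C B (inv T) |T. linear T \<and> bij T}" for x
      using that opnorm[OF B C] opnorm[OF C B lin] by auto
  qed
qed

text \<open>A boundary point of the intersection that lies in the hull has norm ratio 1 or
  \<open>a * b\<close>, and \<open>exists_intermediate_ratio\<close> supplies a direction where
  neither holds.\<close>

lemma not_Int_subset_hull_Un:
  fixes BE BF :: "'a::euclidean_space set"
  assumes dim: "DIM('a) \<ge> 2"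
    and E: "symmetric_convex_body BE" and F: "symmetric_convex_body BF"
    and noniso: "\<not> isometric_spaces BE BF"
    and ab: "a > 1" "b > 1"
    and EF: "BE \<subseteq> BF" and FE: "BF \<subseteq> (*\<^sub>R) (a * b) ` BE"
  shows "\<not> (*\<^sub>R) a ` BE \<inter> BF \<subseteq> convex hull (BE \<union> (*\<^sub>R) (1 / b) ` BF)"
proof
  assume sub: "(*\<^sub>R) a ` BE \<inter> BF \<subseteq> convex hull (BE \<union> (*\<^sub>R) (1 / b) ` BF)"
  let ?e = "body_norm BE" and ?f = "body_norm BF"
  have fe: "?f x \<le> ?e x" for x
    using body_norm_le_if_subset[OF E F, of 1 x] EF by simp
  have ef: "?e x \<le> a * b * ?f x" for x
    using body_norm_le_if_subset[OF F E _ FE] ab by simp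
  obtain x where x: "x \<noteq> 0" "?e x \<noteq> ?f x" "?e x \<noteq> a * b * ?f x"
    using exists_intermediate_ratio[OF dim E F noniso] by blast
  \<comment> \<open>\<open>m\<close> is the norm of \<open>x\<close> for the intersection of
    \<open>a\<close> times \<open>BE\<close> with \<open>BF\<close>, so \<open>y\<close> lies on the
    boundary of that intersection.\<close>
  define m where "m = max (?e x / a) (?f x)"
  have fpos: "?f x > 0" using body_norm_pos[OF F x(1)] .
  then have m: "m > 0" by (simp add: m_def)
  have mge: "?e x / a \<le> m" "?f x \<le> m" by (simp_all add: m_def)
  define y where "y = x /\<^sub>R m"
  have ey: "?e y = ?e x / m" and fy: "?f y = ?f x / m"
    using m by (simp_all add: y_def body_norm_scaleR[OF E] body_norm_scaleR[OF F] divide_inverse_commute)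
  have "?e y \<le> a" "?f y \<le> 1"
    unfolding ey fy using m ab mge by (auto simp: field_simps)
  then have "y \<in> (*\<^sub>R) a ` BE \<inter> BF"
    using body_norm_le_iff[OF E, of a y] body_norm_le_one_iff[OF F, of y] ab by auto
  then have "y \<in> convex hull (BE \<union> (*\<^sub>R) (1 / b) ` BF)" using sub by blast
  moreover have "convex BE" "convex ((*\<^sub>R) (1 / b) ` BF)" "BE \<noteq> {}" "BF \<noteq> {}"
    using E F by (auto simp: symmetric_convex_body_def intro: convex_scaling)
  ultimately obtain u v s t where uv: "u \<ge> 0" "v \<ge> 0" "u + v = 1" "s \<in> BE" "t \<in> BF"
    and y: "y = u *\<^sub>R s + v *\<^sub>R ((1 / b) *\<^sub>R t)"
    using convex_hull_union_two[of BE "(*\<^sub>R) (1 / b) ` BF"] by blast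
  have s: "?e s \<le> 1" "?f s \<le> 1" and t: "?f t \<le> 1" "?e t \<le> a * b"
    using uv body_norm_le_one_iff[OF E, of s] body_norm_le_one_iff[OF F, of t] fe[of s]
      ef[of t] order_trans[OF ef[of t] mult_left_mono[of "?f t" 1 "a * b"]] ab by auto
  have le_e: "?e y \<le> u * ?e s + (v / b) * ?e t"
    unfolding y scaleR_scaleR using body_norm_combination[OF E, of u "v * (1 / b)"] uv ab by simp
  have le_f: "?f y \<le> u * ?f s + (v / b) * ?f t"
    unfolding y scaleR_scaleR using body_norm_combination[OF F, of u "v * (1 / b)"] uv ab by simp
  show False
  proof (cases "?e x / a \<le> ?f x")
    \<comment> \<open>Here \<open>y\<close> is on the boundary of \<open>BF\<close>. The factor
      \<open>1 / b < 1\<close> leaves no weight on \<open>t\<close>, so \<open>y\<close> is in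
      \<open>BE\<close> and the two norms agree at \<open>x\<close>.\<close>
    case True
    then have my: "?f y = 1" using fpos by (simp add: fy m_def)
    have "u * ?f s \<le> u" "(v / b) * ?f t \<le> v / b"
      using s t uv ab by (auto intro!: mult_left_le simp del: times_divide_eq_left)
    then have "1 \<le> u + v / b" using le_f my by simp
    moreover have "u = 1 - v" using uv(3) by simp
    ultimately have "v * (b - 1) \<le> 0" using ab by (simp add: field_simps)
    then have "v = 0" using uv(2) ab by (simp add: mult_le_0_iff)
    then have "y = s" using y uv by simp
    then have "?e y \<le> ?f y" using s(1) my by simp
    then have "?e x \<le> ?f x" using m by (simp add: ey fy divide_le_cancel)
    then show False using fe[of x] x(2) by simp
  next
    \<comment> \<open>Here \<open>y\<close> is on the boundary of \<open>a\<close> times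
      \<open>BE\<close>. Since \<open>a > 1\<close>, no weight is left on \<open>s\<close>, so
      \<open>y\<close> is in \<open>BF\<close> scaled by \<open>1 / b\<close> and the ratio at
      \<open>x\<close> is \<open>a * b\<close>.\<close>
    case False
    then have my: "?e y = a" using ey m ab by (simp add: m_def field_simps)
    have "u * ?e s \<le> u" "(v / b) * ?e t \<le> (v / b) * (a * b)"
      using s t uv ab by (auto intro!: mult_left_le mult_left_mono simp del: times_divide_eq_left)
    then have "a \<le> u + v * a" using le_e my ab by simp
    moreover have "v = 1 - u" using uv(3) by simp
    ultimately have "u * (a - 1) \<le> 0" by (simp add: algebra_simps)
    then have "u = 0" using uv(1) ab by (simp add: mult_le_0_iff)
    then have "y = (1 / b) *\<^sub>R t" using y uv by simp
    then have "?f y \<le> 1 / b"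
      using t(1) ab by (simp add: body_norm_scaleR[OF F] field_simps)
    then have "a * b * ?f y \<le> ?e y" using my ab by (simp add: field_simps)
    then have "a * b * ?f x \<le> ?e x" using m by (simp add: ey fy field_simps)
    then show False using ef[of x] x(3) by simp
  qed
qed

section \<open>Exposed points and bodies with prescribed norms\<close>

text \<open>Any number of points can be taken on a short strictly convex arc starting at
  \<open>q\<close>: each is exposed among them by its own normal, and normals close to a functional
  separating \<open>q\<close> from \<open>C\<close> still separate.\<close>

lemma exists_exposed_points_near:
  fixes B C :: "'a::euclidean_space set" and I :: "'i set"
  assumes dim: "DIM('a) \<ge> 2" and C: "convex C" "compact C" "0 \<in> C"
    and q: "q \<in> interior B" "q \<notin> C" and I: "finite I"
  obtains p v :: "'i \<Rightarrow> 'a" where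
    "\<And>i. i \<in> I \<Longrightarrow> p i \<in> B"
    "\<And>i x. i \<in> I \<Longrightarrow> x \<in> C \<Longrightarrow> v i \<bullet> x < v i \<bullet> p i"
    "\<And>i j. i \<in> I \<Longrightarrow> j \<in> I \<Longrightarrow> 0 \<le> v i \<bullet> p j"
    "\<And>i j. i \<in> I \<Longrightarrow> j \<in> I \<Longrightarrow> i \<noteq> j \<Longrightarrow> v i \<bullet> p j < v i \<bullet> p i"
proof -
  obtain a' \<beta> where "a' \<bullet> q < \<beta>" "\<And>x. x \<in> C \<Longrightarrow> a' \<bullet> x > \<beta>"
    using separating_hyperplane_closed_point[OF C(1) compact_imp_closed[OF C(2)] q(2)] by blast
  \<comment> \<open>\<open>a\<close> is the negated separating functional, and \<open>m\<close> the
    margin by which \<open>q\<close> lies above \<open>C\<close>.\<close>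
  then obtain a m where m: "m > 0" and am: "\<And>x. x \<in> C \<Longrightarrow> a \<bullet> x + m \<le> a \<bullet> q"
    using that by (intro that[of "\<beta> - a' \<bullet> q" "- a'"]) fastforce+
  have "a \<noteq> 0" using am[OF C(3)] m by auto
  have "dim {a} < DIM('a)" using dim \<open>a \<noteq> 0\<close> by simp
  then obtain b where "b \<noteq> 0" and "\<And>y. y \<in> span {a} \<Longrightarrow> orthogonal b y"
    using orthogonal_to_subspace_exists by blast
  then have ab: "a \<bullet> b = 0" "b \<bullet> a = 0"
    by (auto simp: orthogonal_def inner_commute span_base)
  define N where "N = (a \<bullet> a) * (b \<bullet> b)"
  have N: "N > 0" using \<open>a \<noteq> 0\<close> \<open>b \<noteq> 0\<close> by (simp add: N_def)
  obtain K where K: "K > 0" "\<And>x. x \<in> C \<Longrightarrow> norm x \<le> K"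
    using C(2) compact_imp_bounded bounded_pos by metis
  \<comment> \<open>Points on a parabola through \<open>q\<close> opening towards \<open>C\<close>, and normals to it.\<close>
  define P where "P t = q + (t * (a \<bullet> a)) *\<^sub>R b - (t\<^sup>2 / 2 * (b \<bullet> b)) *\<^sub>R a" for t
  define V where "V t = a + t *\<^sub>R b" for t :: real
  \<comment> \<open>For fixed \<open>t\<close> this is a quadratic in \<open>s\<close> whose only
    maximum is at \<open>s = t\<close>.\<close>
  have VP: "V t \<bullet> P s = a \<bullet> q + t * (b \<bullet> q) + N * (t * s - s\<^sup>2 / 2)" for s t
    by (simp add: V_def P_def N_def algebra_simps ab)
  \<comment> \<open>Three smallness conditions: the points stay in \<open>B\<close>, the tilt of the
    normal by \<open>b\<close> costs less than \<open>m / 2\<close> on \<open>C\<close>, and the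
    drop along the parabola costs less than \<open>m / 2\<close>. Together the two costs stay below
    \<open>m\<close>, which yields \<open>nonneg\<close>.\<close>
  have "eventually (\<lambda>t. P t \<in> interior B) (at_right 0)"
  proof (rule topological_tendstoD)
    have "(P \<longlongrightarrow> q + (0 * (a \<bullet> a)) *\<^sub>R b - (0\<^sup>2 / 2 * (b \<bullet> b)) *\<^sub>R a) (at_right 0)"
      unfolding P_def by (intro tendsto_intros) auto
    then show "(P \<longlongrightarrow> q) (at_right 0)" by simp
  qed (use q in auto)
  moreover have "eventually (\<lambda>t. t * (norm b * (norm q + K)) < m / 2) (at_right 0)"
    by (rule order_tendstoD(2)[of _ "0 * (norm b * (norm q + K))"], intro tendsto_intros)
      (use m in auto)
  moreover have "eventually (\<lambda>t. N * (t\<^sup>2 / 2) < m / 2) (at_right 0)"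
    by (rule order_tendstoD(2)[of _ "N * (0\<^sup>2 / 2)"], intro tendsto_intros) (use m in auto)
  ultimately have "eventually (\<lambda>t. P t \<in> interior B \<and> t * (norm b * (norm q + K)) < m / 2 \<and>
      N * (t\<^sup>2 / 2) < m / 2) (at_right 0)"
    by (intro eventually_conj)
  then obtain \<tau> :: real where \<tau>: "\<tau> > 0" and small: "\<And>t. 0 < t \<Longrightarrow> t < \<tau> \<Longrightarrow> P t \<in> interior B"
    "\<And>t. 0 < t \<Longrightarrow> t < \<tau> \<Longrightarrow> t * (norm b * (norm q + K)) < m / 2"
    "\<And>t. 0 < t \<Longrightarrow> t < \<tau> \<Longrightarrow> N * (t\<^sup>2 / 2) < m / 2"
    unfolding eventually_at_right_field by blast
  have bq: "t * (b \<bullet> x) \<ge> t * (b \<bullet> q) - t * (norm b * (norm q + K)) \<and>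
      t * (b \<bullet> x) \<le> t * (b \<bullet> q) + t * (norm b * (norm q + K))"
    if "t > 0" "x \<in> C" for t x
  proof -
    have "\<bar>b \<bullet> (q - x)\<bar> \<le> norm b * norm (q - x)" by (rule Cauchy_Schwarz_ineq2)
    also have "\<dots> \<le> norm b * (norm q + K)"
      using norm_triangle_ineq4[of q x] K(2)[OF that(2)] by (intro mult_left_mono) auto
    finally have "\<bar>b \<bullet> q - b \<bullet> x\<bar> \<le> norm b * (norm q + K)" by (simp add: inner_diff_right)
    then have "t * \<bar>b \<bullet> q - b \<bullet> x\<bar> \<le> t * (norm b * (norm q + K))"
      using that(1) by (intro mult_left_mono) auto
    then have "\<bar>t * (b \<bullet> q) - t * (b \<bullet> x)\<bar> \<le> t * (norm b * (norm q + K))"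
      using that(1) by (simp add: abs_mult flip: right_diff_distrib)
    then show ?thesis by linarith
  qed
  have sepC: "V t \<bullet> x < V t \<bullet> P t" if "0 < t" "t < \<tau>" "x \<in> C" for t x
  proof -
    have "V t \<bullet> x = a \<bullet> x + t * (b \<bullet> x)" by (simp add: V_def algebra_simps)
    moreover have "V t \<bullet> P t = a \<bullet> q + t * (b \<bullet> q) + N * (t\<^sup>2 / 2)"
      by (simp add: VP power2_eq_square)
    moreover have "N * (t\<^sup>2 / 2) \<ge> 0" using N by simp
    ultimately show ?thesis
      using am[OF that(3)] bq[OF that(1,3)] small(2)[OF that(1,2)] m by linarith
  qed
  have nonneg: "0 \<le> V t \<bullet> P s" if "0 < t" "t < \<tau>" "0 < s" "s < \<tau>" for s t
  proof -
    have "V t \<bullet> P s = a \<bullet> q + t * (b \<bullet> q) + N * (t * s) - N * (s\<^sup>2 / 2)"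
      by (simp add: VP algebra_simps)
    moreover have "N * (t * s) \<ge> 0" using N that by simp
    moreover have "t * (b \<bullet> q) \<ge> - (t * (norm b * (norm q + K)))" using bq[OF that(1) C(3)] by simp
    moreover have "a \<bullet> q \<ge> m" using am[OF C(3)] by simp
    ultimately show ?thesis
      using small(2)[OF that(1,2)] small(3)[OF that(3,4)] by linarith
  qed
  have exposed: "V t \<bullet> P s < V t \<bullet> P t" if "s \<noteq> t" for s t
  proof -
    have "V t \<bullet> P t - V t \<bullet> P s = N * ((t - s)\<^sup>2 / 2)"
      by (simp add: VP power2_eq_square field_simps)
    moreover have "N * ((t - s)\<^sup>2 / 2) > 0" using N that by simp
    ultimately show ?thesis by simp
  qed
  obtain g :: "'i \<Rightarrow> nat" where g: "inj_on g I"
    using finite_imp_inj_to_nat_seg[OF I] by blast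
  \<comment> \<open>Distinct parameters; the summand 2 keeps them strictly below
    \<open>\<tau>\<close> even where \<open>g i = 0\<close>.\<close>
  define th where "th i = \<tau> / (real (g i) + 2)" for i
  have th: "0 < th i" "th i < \<tau>" for i
    using \<tau> by (auto simp: th_def field_simps add_pos_nonneg)
  have th_inj: "th i \<noteq> th j" if "i \<in> I" "j \<in> I" "i \<noteq> j" for i j
    using g that \<tau> by (auto simp: th_def field_simps inj_on_def)
  show thesis
  proof (rule that[of "\<lambda>i. P (th i)" "\<lambda>i. V (th i)"])
    show "P (th i) \<in> B" for i using small(1)[OF th] interior_subset by blast
    show "V (th i) \<bullet> x < V (th i) \<bullet> P (th i)" if "x \<in> C" for i x
      using sepC[OF th that] .
    show "0 \<le> V (th i) \<bullet> P (th j)" for i j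
      using nonneg[OF th th] .
    show "V (th i) \<bullet> P (th j) < V (th i) \<bullet> P (th i)" if "i \<in> I" "j \<in> I" "i \<noteq> j" for i j
      using exposed th_inj that by metis
  qed
qed

text \<open>The bodies are the convex hulls of \<open>C\<close> and the points \<open>\<plusminus>p i / u i\<close>, where the \<open>p i\<close> are
  simultaneously exposed.\<close>
lemma exists_bodies_with_prescribed_norms:
  fixes B C :: "'a::euclidean_space set" and I :: "'i set"
  assumes dim: "DIM('a) \<ge> 2" and C: "symmetric_convex_body C"
    and B: "convex B" "closed B" "\<forall>x\<in>B. - x \<in> B"
    and CB: "C \<subseteq> B" "\<not> B \<subseteq> C" and I: "finite I"
  shows "\<exists>(p :: 'i \<Rightarrow> 'a) R. R > 1 \<and> (\<forall>u. (\<forall>i\<in>I. 1 \<le> u i \<and> u i \<le> R) \<longrightarrow>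
    (\<exists>X. symmetric_convex_body X \<and> C \<subseteq> X \<and> X \<subseteq> B \<and> (\<forall>i\<in>I. body_norm X (p i) = u i)))"
proof -
  have C': "convex C" "compact C" "interior C \<noteq> {}"
    using C by (auto simp: symmetric_convex_body_def)
  have z: "0 \<in> C" using body_norm_le_one_iff[OF C, of 0] C by simp
  have "interior B \<noteq> {}" using C'(3) interior_mono[OF CB(1)] by blast
  \<comment> \<open>A closed convex set with interior points is the closure of its interior, so the
    closed set \<open>C\<close> cannot contain \<open>interior B\<close> without containing
    \<open>B\<close>.\<close>
  then have "closure (interior B) = B" using B convex_closure_interior by force
  then have "\<not> interior B \<subseteq> C"
    using CB(2) closure_minimal[OF _ compact_imp_closed[OF C'(2)], of "interior B"] by auto
  then obtain q where q: "q \<in> interior B" "q \<notin> C" by blast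
  obtain p v :: "'i \<Rightarrow> 'a" where p: "\<And>i. i \<in> I \<Longrightarrow> p i \<in> B"
    and sepC: "\<And>i x. i \<in> I \<Longrightarrow> x \<in> C \<Longrightarrow> v i \<bullet> x < v i \<bullet> p i"
    and nonneg: "\<And>i j. i \<in> I \<Longrightarrow> j \<in> I \<Longrightarrow> 0 \<le> v i \<bullet> p j"
    and exposed: "\<And>i j. i \<in> I \<Longrightarrow> j \<in> I \<Longrightarrow> i \<noteq> j \<Longrightarrow> v i \<bullet> p j < v i \<bullet> p i"
    using exists_exposed_points_near[OF dim C'(1,2) z q I] by blast
  have pos: "v i \<bullet> p i > 0" if "i \<in> I" for i using sepC[OF that z] by simp
  \<comment> \<open>By compactness each \<open>v i\<close> stays below
    \<open>v i \<bullet> p i\<close> by a definite factor on \<open>C\<close> and on the other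
    points. Finiteness of \<open>I\<close> allows one common \<open>r < 1\<close>, and
    \<open>R = 1 / r\<close> then makes every \<open>p i\<close> divided by \<open>u i\<close> reach
    at least the level \<open>r * (v i \<bullet> p i)\<close>.\<close>
  have "eventually (\<lambda>r. \<forall>i\<in>I. \<forall>x\<in>C \<union> p ` (I - {i}). v i \<bullet> x \<le> r * (v i \<bullet> p i)) (at_left (1::real))"
    unfolding eventually_ball_finite_distrib[OF I]
  proof
    fix i assume i: "i \<in> I"
    have "compact (C \<union> p ` (I - {i}))"
      using C'(2) I by (intro compact_Un) (auto intro: finite_imp_compact)
    moreover have "C \<union> p ` (I - {i}) \<noteq> {}" using z by blast
    moreover have "continuous_on (C \<union> p ` (I - {i})) (\<lambda>x. v i \<bullet> x)" by (intro continuous_intros)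
    ultimately obtain y where y: "y \<in> C \<union> p ` (I - {i})"
      "\<And>x. x \<in> C \<union> p ` (I - {i}) \<Longrightarrow> v i \<bullet> x \<le> v i \<bullet> y"
      using continuous_attains_sup by metis
    have "v i \<bullet> y < 1 * (v i \<bullet> p i)" using y(1) sepC[OF i] exposed[OF i] by auto
    then have "eventually (\<lambda>r. v i \<bullet> y < r * (v i \<bullet> p i)) (at_left 1)"
      by (intro order_tendstoD(1)[of _ "1 * (v i \<bullet> p i)"] tendsto_intros)
    then show "eventually (\<lambda>r. \<forall>x\<in>C \<union> p ` (I - {i}). v i \<bullet> x \<le> r * (v i \<bullet> p i)) (at_left 1)"
      by eventually_elim (use y(2) in force)
  qed
  moreover have "eventually (\<lambda>r. r > 0) (at_left (1::real))"
    by (intro order_tendstoD(1)[of "\<lambda>x. x" 1]) (auto intro: tendsto_intros)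
  moreover have "eventually (\<lambda>r. r < 1) (at_left (1::real))"
    by (simp add: eventually_at_filter)
  ultimately have "eventually (\<lambda>r. (\<forall>i\<in>I. \<forall>x\<in>C \<union> p ` (I - {i}). v i \<bullet> x \<le> r * (v i \<bullet> p i)) \<and>
      r > 0 \<and> r < 1) (at_left (1::real))"
    by (intro eventually_conj)
  then obtain r :: real where r: "r > 0" "r < 1"
    and all: "\<forall>i\<in>I. \<forall>x\<in>C \<union> p ` (I - {i}). v i \<bullet> x \<le> r * (v i \<bullet> p i)"
    by (auto dest!: eventually_happens'[OF trivial_limit_at_left_real])
  have gap: "v i \<bullet> x \<le> r * (v i \<bullet> p i)" if "i \<in> I" "x \<in> C \<union> p ` (I - {i})" for i x
    using all that by blast
  show ?thesis
  proof (intro exI conjI allI impI)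
    show "1 / r > 1" using r by simp
    fix u :: "'i \<Rightarrow> real" assume "\<forall>i\<in>I. 1 \<le> u i \<and> u i \<le> 1 / r"
    then have u: "1 \<le> u i \<and> u i \<le> 1 / r" if "i \<in> I" for i using that by blast
    have upos: "u i > 0" "r \<le> 1 / u i" "1 / u i \<le> 1" if "i \<in> I" for i
      using u[OF that] r by (auto simp: field_simps)
    define w where "w i = p i /\<^sub>R u i" for i
    define X where "X = convex hull (C \<union> (w ` I \<union> uminus ` w ` I))"
    have X: "symmetric_convex_body X"
      unfolding X_def using C I
      by (intro symmetric_convex_body_hull_Un) (auto intro!: finite_imp_compact)
    have "w i \<in> B" if "i \<in> I" for i
    proof -
      have "(1 / u i) *\<^sub>R p i + (1 - 1 / u i) *\<^sub>R 0 \<in> B"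
        using p[OF that] upos[OF that] z CB(1) by (intro convexD[OF B(1)]) auto
      then show ?thesis by (simp add: w_def divide_inverse)
    qed
    then have "X \<subseteq> B"
      unfolding X_def using B(1,3) CB(1) by (intro hull_minimal) auto
    moreover have "C \<subseteq> X" unfolding X_def using hull_subset by (rule order_trans[rotated]) auto
    moreover have "body_norm X (p i) = u i" if i: "i \<in> I" for i
    proof (rule antisym)
      have "w i \<in> X" unfolding X_def using i by (auto intro: hull_inc)
      then show "body_norm X (p i) \<le> u i"
        using upos(1)[OF i] by (simp add: body_norm_le_iff[OF X] mem_scaleR_image_iff w_def)
      \<comment> \<open>This half-space has \<open>w i\<close> on its boundary and contains all of
        \<open>X\<close>: \<open>C\<close> and the other \<open>w j\<close> by the choice of
        \<open>r\<close>, the reflected points because \<open>v i\<close> is nonnegative on every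
        \<open>p j\<close>.\<close>
      let ?H = "{x. v i \<bullet> x \<le> (v i \<bullet> p i) / u i}"
      have r_le: "r * (v i \<bullet> p i) \<le> (v i \<bullet> p i) / u i"
        using mult_right_mono[OF upos(2)[OF i], of "v i \<bullet> p i"] pos[OF i] by simp
      have "w j \<in> ?H \<and> - w j \<in> ?H" if j: "j \<in> I" for j
      proof -
        have vw: "v i \<bullet> w j = (v i \<bullet> p j) / u j" by (simp add: w_def divide_inverse_commute)
        have "0 \<le> v i \<bullet> w j" using vw nonneg[OF i j] upos(1)[OF j] by simp
        moreover have "0 \<le> (v i \<bullet> p i) / u i" using pos[OF i] upos(1)[OF i] by simp
        moreover have "v i \<bullet> w j \<le> (v i \<bullet> p i) / u i"
        proof (cases "j = i")
          case False
          have "v i \<bullet> w j \<le> v i \<bullet> p j"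
            unfolding vw using mult_left_le[OF upos(3)[OF j] nonneg[OF i j]] by simp
          also have "\<dots> \<le> r * (v i \<bullet> p i)" using gap[OF i, of "p j"] j False by auto
          finally show ?thesis using r_le by simp
        qed (use vw in simp)
        ultimately show ?thesis by simp
      qed
      moreover have "C \<subseteq> ?H" using gap[OF i] r_le by force
      ultimately have "X \<subseteq> ?H"
        unfolding X_def by (intro hull_minimal) (auto simp: convex_halfspace_le)
      then have "v i \<bullet> p i \<le> (v i \<bullet> p i) / u i * body_norm X (p i)"
        by (intro inner_le_body_norm[OF X]) auto
      then show "u i \<le> body_norm X (p i)"
        using pos[OF i] upos(1)[OF i] by (simp add: field_simps)
    qed
    ultimately show "symmetric_convex_body X" "C \<subseteq> X" "X \<subseteq> B" "\<forall>i\<in>I. body_norm X (p i) = u i"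
      using X by blast+
  qed
qed

section \<open>Null sets and the dimension count\<close>

text \<open>The factor \<open>real\<close> only provides a space with one dimension more than the matrices, in which
  they form a null set; it also serves as the index space for the points \<open>p b\<close>.\<close>
lemma negligible_image_norms_of_linear_images:
  fixes p :: "(real^'n^'n) \<times> real \<Rightarrow> real^'n"
  assumes Y: "symmetric_convex_body Y"
  defines "g \<equiv> \<lambda>M :: (real^'n^'n) \<times> real. \<Sum>b\<in>Basis. body_norm Y (fst M *v p b) *\<^sub>R b"
  shows "negligible (g ` (UNIV \<times> {0}))"
proof -
  have "(0, 1) \<in> (Basis :: ((real^'n^'n) \<times> real) set)" by (simp add: Basis_prod_def)
  then have "negligible {M :: (real^'n^'n) \<times> real. M \<bullet> (0, 1) = 0}"
    by (rule negligible_standard_hyperplane)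
  moreover have "{M :: (real^'n^'n) \<times> real. M \<bullet> (0, 1) = 0} = UNIV \<times> {0}" by auto
  ultimately have neg: "negligible (UNIV \<times> {0} :: ((real^'n^'n) \<times> real) set)" by simp
  obtain K where K: "K > 0" "\<And>x y. \<bar>body_norm Y x - body_norm Y y\<bar> \<le> K * norm (x - y)"
    by (rule body_norm_Lipschitz[OF Y]) blast
  have "bounded_linear (\<lambda>M :: (real^'n^'n) \<times> real. fst M *v x)" for x :: "real^'n"
    by (simp add: linear_iff matrix_vector_mult_add_rdistrib scaleR_matrix_vector_assoc
        flip: linear_conv_bounded_linear)
  then have "\<forall>x. \<exists>L. \<forall>M. norm (fst M *v x) \<le> norm (M :: (real^'n^'n) \<times> real) * L"
    using bounded_linear.bounded by blast
  then obtain L where L: "norm (fst M *v x) \<le> norm M * L x"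
    for M :: "(real^'n^'n) \<times> real" and x :: "real^'n"
    by metis
  \<comment> \<open>The vectors \<open>fst M *v p b\<close> depend linearly on \<open>M\<close> and
    the norm is Lipschitz, so \<open>g\<close> is Lipschitz. As a map of a space into itself it
    preserves null sets.\<close>
  have "norm (g M' - g M) \<le> (\<Sum>b\<in>Basis. K * L (p b)) * norm (M' - M)" for M M'
  proof -
    have "norm (g M' - g M)
        = norm (\<Sum>b\<in>Basis. (body_norm Y (fst M' *v p b) - body_norm Y (fst M *v p b)) *\<^sub>R b)"
      by (simp add: g_def scaleR_diff_left sum_subtractf)
    also have "\<dots> \<le> (\<Sum>b\<in>Basis. K * L (p b) * norm (M' - M))"
    proof (rule sum_norm_le)
      fix b :: "(real^'n^'n) \<times> real" assume "b \<in> Basis"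
      then have "norm ((body_norm Y (fst M' *v p b) - body_norm Y (fst M *v p b)) *\<^sub>R b)
          \<le> K * norm (fst M' *v p b - fst M *v p b)"
        using K(2) by simp
      also have "fst M' *v p b - fst M *v p b = fst (M' - M) *v p b"
        by (simp add: matrix_vector_mult_diff_rdistrib)
      also have "K * norm (fst (M' - M) *v p b) \<le> K * (norm (M' - M) * L (p b))"
        using K(1) L[of "M' - M" "p b"] by (intro mult_left_mono) auto
      finally show "norm ((body_norm Y (fst M' *v p b) - body_norm Y (fst M *v p b)) *\<^sub>R b)
          \<le> K * L (p b) * norm (M' - M)"
        by (simp add: mult_ac)
    qed
    finally show ?thesis by (simp add: sum_distrib_right)
  qed
  then show ?thesis
    by (intro negligible_locally_Lipschitz_image neg) blast+
qed

text \<open>A transversal \<open>S\<close> of the isometry classes indexes null sets that cover a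
  cube of positive volume, so \<open>S\<close> cannot be countable.\<close>

lemma uncountable_nonisometric_between:
  fixes B C :: "(real^'n) set"
  assumes dim: "CARD('n) \<ge> 2" and C: "symmetric_convex_body C"
    and B: "convex B" "closed B" "\<forall>x\<in>B. - x \<in> B"
    and CB: "C \<subseteq> B" "\<not> B \<subseteq> C"
  shows "\<exists>S \<subseteq> {X. symmetric_convex_body X \<and> C \<subseteq> X \<and> X \<subseteq> B}.
           uncountable S \<and> pairwise (\<lambda>X Y. \<not> isometric_spaces X Y) S"
proof -
  let ?G = "{X. symmetric_convex_body X \<and> C \<subseteq> X \<and> X \<subseteq> B}"
  let ?I = "Basis :: ((real^'n^'n) \<times> real) set"
  have dim': "DIM(real^'n) \<ge> 2" using dim by simp
  obtain p :: "(real^'n^'n) \<times> real \<Rightarrow> real^'n" and R :: real where R: "R > 1"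
    and p: "\<forall>u. (\<forall>i\<in>?I. 1 \<le> u i \<and> u i \<le> R) \<longrightarrow>
      (\<exists>X. symmetric_convex_body X \<and> C \<subseteq> X \<and> X \<subseteq> B \<and> (\<forall>i\<in>?I. body_norm X (p i) = u i))"
    using exists_bodies_with_prescribed_norms[where I = ?I, OF dim' C B CB finite_Basis]
    by (elim exE conjE) (rule that)
  obtain S where S: "S \<subseteq> ?G" "pairwise (\<lambda>X Y. \<not> isometric_spaces X Y) S"
    and rep: "\<forall>X\<in>?G. \<exists>Y\<in>S. isometric_spaces X Y"
    using exists_isometry_transversal[of ?G] by (elim exE conjE)
  define g where "g Y M = (\<Sum>b\<in>?I. body_norm Y (fst M *v p b) *\<^sub>R b)"
    for Y :: "(real^'n) set" and M :: "(real^'n^'n) \<times> real"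
  have cover: "cbox One (R *\<^sub>R One) \<subseteq> (\<Union>Y\<in>S. g Y ` (UNIV \<times> {0}))"
  proof
    fix u :: "(real^'n^'n) \<times> real" assume "u \<in> cbox One (R *\<^sub>R One)"
    then have "1 \<le> u \<bullet> i \<and> u \<bullet> i \<le> R" if "i \<in> ?I" for i
      using that by (auto simp: mem_box)
    then obtain X where X: "X \<in> ?G" "\<And>i. i \<in> ?I \<Longrightarrow> body_norm X (p i) = u \<bullet> i"
      using p[rule_format, of "\<lambda>i. u \<bullet> i"] by blast
    obtain Y where Y: "Y \<in> S" and "isometric_spaces X Y" using bspec[OF rep X(1)] by blast
    then obtain T where T: "linear T" "\<And>x. body_norm Y (T x) = body_norm X x"
      unfolding isometric_spaces_def by blast
    \<comment> \<open>As \<open>T\<close> is an isometry from \<open>X\<close> to \<open>Y\<close>,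
      the \<open>Y\<close>-norms of the images of the points \<open>p b\<close> are their
      \<open>X\<close>-norms, which are the coordinates of \<open>u\<close>.\<close>
    have "g Y (matrix T, 0) = (\<Sum>b\<in>?I. (u \<bullet> b) *\<^sub>R b)"
      using X(2) T by (simp add: g_def matrix_works)
    then have "u = g Y (matrix T, 0)" by (simp add: euclidean_representation)
    then show "u \<in> (\<Union>Y\<in>S. g Y ` (UNIV \<times> {0}))" using Y by blast
  qed
  have "uncountable S"
  proof
    assume "countable S"
    then have "negligible (\<Union>Y\<in>S. g Y ` (UNIV \<times> {0}))"
      using S(1) unfolding g_def
      by (intro negligible_countable_Union) (auto intro!: negligible_image_norms_of_linear_images)
    then have "negligible (cbox One (R *\<^sub>R One) :: ((real^'n^'n) \<times> real) set)"
      using cover by (rule negligible_subset)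
    moreover have "box One (R *\<^sub>R One :: (real^'n^'n) \<times> real) \<noteq> {}"
      using R by (simp add: box_ne_empty)
    ultimately show False by (simp add: negligible_interval)
  qed
  then show ?thesis using S by blast
qed

section \<open>The bodies between the inner and the outer body\<close>

theorem theorem2:
  fixes BE BF :: "(real ^ 'n) set" and l :: real
  assumes "CARD('n) \<ge> 3"
    and "symmetric_convex_body BE"
    and "symmetric_convex_body BF"
    and "\<not> isometric_spaces BE BF"
    and "BE \<subseteq> BF"
    and "BF \<subseteq> (*\<^sub>R) (banach_mazur_dist BE BF) ` BE"
    and "0 < l" and "l < 1"
  shows "\<exists>S \<subseteq> {BX. symmetric_convex_body BX \<and>
                inner_body l BE BF \<subseteq> BX \<and> BX \<subseteq> outer_body l BE BF}.
           uncountable S \<and> pairwise (\<lambda>X Y. \<not> isometric_spaces X Y) S"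
proof -
  note E = assms(2) and F = assms(3)
  define d where "d = banach_mazur_dist BE BF"
  define a where "a = d powr l"
  define b where "b = d powr (1 - l)"
  have dim: "DIM(real^'n) \<ge> 2" "CARD('n) \<ge> 2" using assms(1) by auto
  have FE: "BF \<subseteq> (*\<^sub>R) d ` BE" using assms(6) by (simp add: d_def)
  have d0: "d > 0"
  proof -
    \<comment> \<open>Scaling by 0 would squeeze \<open>BF\<close> into a single point.\<close>
    have "d \<noteq> 0"
    proof
      assume "d = 0"
      then have "interior BF \<subseteq> interior {0}" using FE by (intro interior_mono) auto
      then show False using F by (auto simp: symmetric_convex_body_def)
    qed
    then show ?thesis using banach_mazur_dist_nonneg[OF E F] by (simp add: d_def)
  qed
  have fe: "body_norm BF x \<le> body_norm BE x" for x
    using body_norm_le_if_subset[OF E F, of 1 x] assms(5) by simp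
  have ef: "body_norm BE x \<le> d * body_norm BF x" for x
    by (rule body_norm_le_if_subset[OF F E d0 FE])
  \<comment> \<open>For \<open>d\<close> at most 1 the inequalities \<open>fe\<close> and
    \<open>ef\<close> force equal norms, against non-isometry.\<close>
  have d1: "d > 1"
  proof (rule ccontr)
    assume "\<not> d > 1"
    then have "d * body_norm BF x \<le> 1 * body_norm BF x" for x
      using body_norm_nonneg[OF F] by (intro mult_right_mono) auto
    then have "body_norm BE x = 1 * body_norm BF x" for x
      using fe[of x] ef[of x] by (smt (verit) mult_1)
    then show False using isometric_spaces_if_proportional[OF F, of 1 BE] assms(4) by simp
  qed
  have ab: "a > 1" "b > 1" and d: "d = a * b"
    using d1 assms(7,8) by (simp_all add: a_def b_def flip: powr_add)
  have inner: "inner_body l BE BF = convex hull (BE \<union> (*\<^sub>R) (1 / b) ` BF)"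
    and outer: "outer_body l BE BF = (*\<^sub>R) a ` BE \<inter> BF"
    by (simp_all add: inner_body_def outer_body_def a_def b_def d_def)
  have cF: "convex BF" "compact BF" "\<And>x. x \<in> BF \<Longrightarrow> - x \<in> BF"
    and cE: "convex BE" "compact BE" "\<And>x. x \<in> BE \<Longrightarrow> - x \<in> BE"
    using E F by (auto simp: symmetric_convex_body_def)
  have z: "0 \<in> BE" "0 \<in> BF"
    using body_norm_le_one_iff[OF E, of 0] body_norm_le_one_iff[OF F, of 0] E F by simp_all
  have shrink: "t *\<^sub>R x \<in> A" if "convex A" "0 \<in> A" "x \<in> A" "0 \<le> t" "t \<le> 1"
    for t x and A :: "(real^'n) set"
    using convexD[OF that(1,3,2), of t "1 - t"] that by simp
  have convex_outer: "convex (outer_body l BE BF)"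
    unfolding outer by (intro convex_Int convex_scaling cE cF)
  have BE_sub: "BE \<subseteq> (*\<^sub>R) a ` BE"
  proof
    fix x assume "x \<in> BE"
    then have "x /\<^sub>R a \<in> BE" using shrink[OF cE(1) z(1), of x "inverse a"] ab(1) by (simp add: field_simps)
    then show "x \<in> (*\<^sub>R) a ` BE" using ab(1) by (simp add: mem_scaleR_image_iff)
  qed
  \<comment> \<open>Since \<open>d = a * b\<close>, shrinking \<open>BF\<close> by \<open>b\<close>
    moves it from inside \<open>d\<close> times \<open>BE\<close> to inside \<open>a\<close> times
    \<open>BE\<close>.\<close>
  have "(1 / b) *\<^sub>R x \<in> (*\<^sub>R) a ` BE \<inter> BF" if x: "x \<in> BF" for x
  proof
    show "(1 / b) *\<^sub>R x \<in> BF" using shrink[OF cF(1) z(2) x, of "1 / b"] ab(2) by simp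
    obtain y where "y \<in> BE" "x = (a * b) *\<^sub>R y" using FE x d by auto
    then show "(1 / b) *\<^sub>R x \<in> (*\<^sub>R) a ` BE" using ab(2) by auto
  qed
  then have sub: "inner_body l BE BF \<subseteq> outer_body l BE BF"
    using BE_sub assms(5) convex_outer unfolding inner
    by (intro hull_minimal) (auto simp: outer)
  show ?thesis
  proof (rule uncountable_nonisometric_between[OF dim(2) _ convex_outer _ _ sub])
    show "symmetric_convex_body (inner_body l BE BF)"
      unfolding inner using cF
      by (intro symmetric_convex_body_hull_Un E compact_scaling) (auto simp flip: scaleR_minus_right)
    show "closed (outer_body l BE BF)"
      unfolding outer by (intro closed_Int compact_imp_closed compact_scaling cE cF)
    show "\<forall>x\<in>outer_body l BE BF. - x \<in> outer_body l BE BF"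
      using cE(3) cF(3) unfolding outer by (auto simp flip: scaleR_minus_right)
    show "\<not> outer_body l BE BF \<subseteq> inner_body l BE BF"
      unfolding inner outer
      by (rule not_Int_subset_hull_Un[OF dim(1) E F assms(4) ab assms(5)]) (use FE d in simp)
  qed
qed

end
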